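(* Let $A$ be a non-empty closed subset of $E^{n}$. Then $A$ is convex if and only if each pair of boundary points of $A$ is either flat or hyperbolic.
   Context: $E^{n}$ is the $n$-dimensional Euclidean space, $n\ge 1$. For $A\subset E^n$, $\mathrm{int}(A)$ and $\partial A$ denote the interior and boundary of $A$. For points $p,q$, $[pq]$ is the closed segment joining them and $(pq)=[pq]\setminus\{p,q\}$ is the open segment. A pair of distinct boundary points $p,q\in\partial A$ is called flat (or parabolic) if $(pq)\subset \partial A$, and hyperbolic if $(pq)\subset \mathrm{int}(A)$; "each pair of boundary points" means each pair of distinct points of $\partial A$. *)

theory Defs
  imports "HOL-Analysis.Analysis"
begin

definition flat_pair :: "(real ^ 'n) set \<Rightarrow> real ^ 'n \<Rightarrow> real ^ 'n \<Rightarrow> bool" where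
  "flat_pair A p q \<longleftrightarrow>
     p \<in> frontier A \<and> q \<in> frontier A \<and> p \<noteq> q \<and> open_segment p q \<subseteq> frontier A"

definition hyperbolic_pair :: "(real ^ 'n) set \<Rightarrow> real ^ 'n \<Rightarrow> real ^ 'n \<Rightarrow> bool" where
  "hyperbolic_pair A p q \<longleftrightarrow>
     p \<in> frontier A \<and> q \<in> frontier A \<and> p \<noteq> q \<and> open_segment p q \<subseteq> interior A"

end

theory Submission
  imports Defs
begin

text \<open>For convex \<open>A\<close>, one interior point on the open segment from
  \<open>p\<close> to \<open>q\<close> forces the whole open segment into the interior; without such
  a point the segment, lying in the closed set \<open>A\<close>, lies in the frontier
  (\<open>convex_open_segment_subset_frontier_or_interior\<close>). Conversely, if a segment with
  ends in \<open>A\<close> leaves \<open>A\<close> at \<open>z\<close>, then on each side of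
  \<open>z\<close> it meets the frontier, at \<open>p\<close> and \<open>q\<close> say. Now
  \<open>z\<close> lies strictly between \<open>p\<close> and \<open>q\<close>
  (\<open>in_open_segment_of_nested\<close>), so the pair can be neither flat nor hyperbolic: either
  would put \<open>z\<close> in \<open>A\<close>.\<close>

lemma in_open_segment_of_nested:
  fixes x y z p q :: "'a :: euclidean_space"
  assumes "z \<in> closed_segment x y" "p \<in> closed_segment x z" "q \<in> closed_segment z y"
    and "p \<noteq> z" "q \<noteq> z"
  shows "z \<in> open_segment p q"
proof -
  \<comment> \<open>The path \<open>x\<close>, \<open>p\<close>, \<open>z\<close>, \<open>q\<close>,
    \<open>y\<close> has total length \<open>dist x y\<close>, so it is shortest; hence its part
    \<open>p\<close>, \<open>z\<close>, \<open>q\<close> is shortest as well, and \<open>z\<close>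
    is between \<open>p\<close> and \<open>q\<close>.\<close>
  have "dist x y = dist x z + dist z y" "dist x z = dist x p + dist p z" "dist z y = dist z q + dist q y"
    using assms(1-3) by (simp_all flip: between_mem_segment add: between)
  moreover have "dist x y \<le> dist x p + dist p q + dist q y" "dist p q \<le> dist p z + dist z q"
    using dist_triangle[of x y p] dist_triangle[of p y q] dist_triangle[of p q z] by linarith+
  ultimately have "dist p q = dist p z + dist z q"
    by linarith
  then have "z \<in> closed_segment p q"
    by (simp flip: between_mem_segment add: between)
  then show ?thesis
    using assms(4,5) by (auto simp: open_segment_def)
qed

lemma convex_open_segment_subset_frontier_or_interior:
  fixes A :: "'a :: euclidean_space set"
  assumes "convex A" "closed A" "p \<in> A" "q \<in> A"
  shows "open_segment p q \<subseteq> frontier A \<or> open_segment p q \<subseteq> interior A"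
proof (cases "open_segment p q \<inter> interior A = {}")
  case True
  have "open_segment p q \<subseteq> A"
    using assms closed_segment_subset[of p A q] segment_open_subset_closed[of p q] by blast
  then show ?thesis
    using True assms(2) by (auto simp: frontier_def)
next
  case False
  then obtain m where m: "m \<in> open_segment p q" "m \<in> interior A"
    by blast
  \<comment> \<open>Some ball around \<open>m\<close> lies in \<open>A\<close>; shrinking it towards
    \<open>r\<close> gives a ball in \<open>A\<close> around each point of the open segment.\<close>
  have "open_segment m r \<subseteq> interior A" if "r \<in> A" for r
    using in_interior_closure_convex_segment[OF assms(1) m(2)] that closure_subset by blast
  then have "open_segment p m \<subseteq> interior A" "open_segment m q \<subseteq> interior A"
    using assms(3,4) by (metis open_segment_commute)+
  moreover have "open_segment p q \<subseteq> open_segment p m \<union> {m} \<union> open_segment m q"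
    using Un_closed_segment[of m p q] m(1) unfolding open_segment_def by blast
  ultimately show ?thesis
    using m(2) by blast
qed

theorem corollary5:
  fixes A :: "(real ^ 'n) set"
  assumes "A \<noteq> {}" and "closed A"
  shows "convex A \<longleftrightarrow>
    (\<forall>p \<in> frontier A. \<forall>q \<in> frontier A. p \<noteq> q \<longrightarrow> flat_pair A p q \<or> hyperbolic_pair A p q)"
    (is "_ \<longleftrightarrow> ?R")
proof
  assume "convex A"
  then show ?R
    using convex_open_segment_subset_frontier_or_interior[OF _ assms(2)] frontier_subset_closed[OF assms(2)]
    unfolding flat_pair_def hyperbolic_pair_def by blast
next
  assume pairs: ?R
  show "convex A"
  proof (rule ccontr)
    assume "\<not> convex A"
    then obtain x y z where xy: "x \<in> A" "y \<in> A" and z: "z \<in> closed_segment x y" "z \<notin> A"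
      by (auto simp: convex_contains_segment)
    \<comment> \<open>A connected set that meets both \<open>A\<close> and its complement meets the
      frontier.\<close>
    have "closed_segment w z \<inter> frontier A \<noteq> {}" if "w \<in> A" for w
      using that z(2) by (intro connected_Int_frontier) auto
    then obtain p q where p: "p \<in> closed_segment x z" "p \<in> frontier A"
      and q: "q \<in> closed_segment z y" "q \<in> frontier A"
      using xy by (metis closed_segment_commute disjoint_iff)
    have frontier_A: "frontier A \<subseteq> A"
      using frontier_subset_closed[OF assms(2)] .
    \<comment> \<open>Closedness puts \<open>p\<close> and \<open>q\<close> in \<open>A\<close>, so
      both differ from \<open>z\<close>.\<close>
    then have "z \<in> open_segment p q"
      using in_open_segment_of_nested[OF z(1) p(1) q(1)] p(2) q(2) z(2) by blast
    moreover from this have "p \<noteq> q"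
      by auto
    ultimately have "z \<in> frontier A \<or> z \<in> interior A"
      using pairs p(2) q(2) unfolding flat_pair_def hyperbolic_pair_def by blast
    then show False
      using z(2) frontier_A interior_subset by blast
  qed
qed

end
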